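(* Let $N=(\Gamma,B)$ be a network. The Dirichlet matroid $M(N)$ is (Tutte) 3-connected if and only if the graph $\Gamma\setminus B$ is connected and the graph $\hat\Gamma$, obtained from $\Gamma$ by adding an edge between every pair of boundary nodes, is 3-connected.
   Context: A network $N=(\Gamma,B)$ consists of a finite connected graph $\Gamma=(V,E)$ with no loops or multiple edges and a set $B\subsetneq V$ of at least 2 vertices (boundary nodes), no two of which are adjacent; vertices in $V\setminus B$ are interior. The Dirichlet matroid $M(N)$: fix an injective $u:B\to\mathbb{R}$ and a new symbol $e_0\notin E$; in $\mathbb{R}^{(V\setminus B)\cup\{0\}}$ assign to each edge $ij$ with $i,j$ interior the vector $\mathbf{e}_i-\mathbf{e}_j$, to each edge $ij$ with $i$ interior and $j\in B$ the vector $\mathbf{e}_i-u(j)\mathbf{e}_0$, and to $e_0$ the vector $\mathbf{e}_0$; $M(N)$ is the matroid of linear independence of these vectors on $E\cup\{e_0\}$ (independent of the choice of injective $u$). $\Gamma\setminus B$ denotes the graph obtained by deleting the boundary nodes and incident edges. *)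

theory Defs
  imports "HOL-Analysis.Analysis"
begin

subsection \<open>Finite simple graphs\<close>

definition simple_graph :: "'v set \<Rightarrow> 'v set set \<Rightarrow> bool" where
  "simple_graph V E \<longleftrightarrow> finite V \<and> (\<forall>e\<in>E. e \<subseteq> V \<and> card e = 2)"

definition adj_rel :: "'v set set \<Rightarrow> ('v \<times> 'v) set" where
  "adj_rel E = {(x, y). {x, y} \<in> E}"

definition connected_graph :: "'v set \<Rightarrow> 'v set set \<Rightarrow> bool" where
  "connected_graph V E \<longleftrightarrow> V \<noteq> {} \<and> (\<forall>x\<in>V. \<forall>y\<in>V. (x, y) \<in> (adj_rel E)\<^sup>*)"

definition delete_vertices :: "'v set set \<Rightarrow> 'v set \<Rightarrow> 'v set set" where
  "delete_vertices E S = {e \<in> E. e \<inter> S = {}}"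

text \<open>
  Deleting fewer than \<open>k\<close> vertices always leaves a (nonempty) connected graph.  In
  particular the complete graph on \<open>k\<close> vertices counts as \<open>k\<close>-connected; this agrees with
  the convention requiring more than \<open>k\<close> vertices on every graph that does not have exactly
  \<open>k\<close> vertices.  For \<open>k = 3\<close> the only difference is the triangle, whose graphic matroid is
  3-connected in the sense of Tutte.
\<close>
definition k_connected_graph :: "nat \<Rightarrow> 'v set \<Rightarrow> 'v set set \<Rightarrow> bool" where
  "k_connected_graph k V E \<longleftrightarrow>
     (\<forall>S. S \<subseteq> V \<and> card S < k \<longrightarrow> connected_graph (V - S) (delete_vertices E S))"

subsection \<open>Matroids and Tutte connectivity\<close>

locale matroid =
  fixes ground :: "'a set" and indep :: "'a set \<Rightarrow> bool"
  assumes finite_ground: "finite ground"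
    and indep_subset_ground: "indep X \<Longrightarrow> X \<subseteq> ground"
    and indep_empty: "indep {}"
    and indep_subset: "indep X \<Longrightarrow> Y \<subseteq> X \<Longrightarrow> indep Y"
    and augmentation: "indep X \<Longrightarrow> indep Y \<Longrightarrow> card X < card Y \<Longrightarrow>
           \<exists>y\<in>Y - X. indep (insert y X)"

definition matroid_rank :: "('a set \<Rightarrow> bool) \<Rightarrow> 'a set \<Rightarrow> nat" where
  "matroid_rank indep X = Max (card ` {Y. Y \<subseteq> X \<and> indep Y})"

text \<open>
  The rank condition is \<open>r(X) + r(Y) - r(M) \<le> k - 1\<close>, written without subtraction on
  natural numbers.
\<close>
definition tutte_separation ::
    "nat \<Rightarrow> 'a set \<Rightarrow> ('a set \<Rightarrow> bool) \<Rightarrow> 'a set \<Rightarrow> 'a set \<Rightarrow> bool" where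
  "tutte_separation k ground indep X Y \<longleftrightarrow>
     X \<union> Y = ground \<and> X \<inter> Y = {} \<and> k \<le> card X \<and> k \<le> card Y \<and>
     matroid_rank indep X + matroid_rank indep Y < matroid_rank indep ground + k"

definition tutte_connected :: "nat \<Rightarrow> 'a set \<Rightarrow> ('a set \<Rightarrow> bool) \<Rightarrow> bool" where
  "tutte_connected n ground indep \<longleftrightarrow>
     (\<forall>k. 1 \<le> k \<and> k < n \<longrightarrow> \<not> (\<exists>X Y. tutte_separation k ground indep X Y))"

text \<open>
  The vectors form a family indexed by the ground set: two different elements carrying the
  same vector are parallel, hence the injectivity condition.
\<close>
definition vector_matroid_indep ::
    "'a set \<Rightarrow> ('a \<Rightarrow> 'b::real_vector) \<Rightarrow> 'a set \<Rightarrow> bool" where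
  "vector_matroid_indep ground f X \<longleftrightarrow> X \<subseteq> ground \<and> inj_on f X \<and> independent (f ` X)"

lemma matroid_vector_matroid:
  assumes "finite ground"
  shows "matroid ground (vector_matroid_indep ground f)"
proof
  show "finite ground" by fact
next
  fix X assume "vector_matroid_indep ground f X"
  then show "X \<subseteq> ground" by (simp add: vector_matroid_indep_def)
next
  show "vector_matroid_indep ground f {}"
    by (simp add: vector_matroid_indep_def independent_empty)
next
  fix X Y assume X: "vector_matroid_indep ground f X" and "Y \<subseteq> X"
  then have "Y \<subseteq> ground" "inj_on f Y" "f ` Y \<subseteq> f ` X"
    by (auto simp: vector_matroid_indep_def intro: inj_on_subset)
  moreover have "independent (f ` X)" using X by (simp add: vector_matroid_indep_def)
  ultimately show "vector_matroid_indep ground f Y"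
    unfolding vector_matroid_indep_def by (simp add: independent_mono[of "f ` X" "f ` Y"])
next
  fix X Y
  assume X: "vector_matroid_indep ground f X" and Y: "vector_matroid_indep ground f Y"
    and less: "card X < card Y"
  show "\<exists>y\<in>Y - X. vector_matroid_indep ground f (insert y X)"
  proof (rule ccontr)
    assume none: "\<not> ?thesis"
    have "f y \<in> span (f ` X)" if "y \<in> Y" for y
    proof (rule ccontr)
      assume notin: "f y \<notin> span (f ` X)"
      then have fy: "f y \<notin> f ` X" using span_base[of "f y" "f ` X"] by argo
      then have "y \<notin> X" by (metis imageI)
      moreover have "independent (insert (f y) (f ` X))"
        using X notin by (simp add: vector_matroid_indep_def independent_insert)
      moreover have "y \<in> ground" using Y that by (auto simp: vector_matroid_indep_def)
      ultimately have "vector_matroid_indep ground f (insert y X)"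
        using X fy by (simp add: vector_matroid_indep_def)
      with none that \<open>y \<notin> X\<close> show False by blast
    qed
    then have sub: "f ` Y \<subseteq> span (f ` X)" by blast
    have "finite X"
      using X assms by (auto simp: vector_matroid_indep_def intro: finite_subset)
    then have "card (f ` Y) \<le> card (f ` X)"
      using independent_span_bound[OF _ _ sub] Y by (simp add: vector_matroid_indep_def)
    then show False
      using X Y less by (simp add: vector_matroid_indep_def card_image)
  qed
qed

subsection \<open>Networks and the Dirichlet matroid\<close>

locale network =
  fixes V :: "'v set" and E :: "'v set set" and B :: "'v set"
  assumes simple: "simple_graph V E"
    and connected: "connected_graph V E"
    and boundary_subset: "B \<subset> V"
    and boundary_card: "2 \<le> card B"
    and boundary_nonadjacent: "x \<in> B \<Longrightarrow> y \<in> B \<Longrightarrow> {x, y} \<notin> E"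

text \<open>
  The ground set is \<open>E\<close> together with a new element \<open>e\<^sub>0\<close>, encoded by \<^const>\<open>None\<close>.
\<close>
definition dirichlet_ground :: "'v set set \<Rightarrow> 'v set option set" where
  "dirichlet_ground E = insert None (Some ` E)"

text \<open>
  The coordinate of an interior vertex \<open>i\<close> is \<open>Some i\<close>, and the extra coordinate \<open>0\<close> is
  \<^const>\<open>None\<close>.  The remaining coordinates of \<^typ>\<open>real ^ 'v option\<close> (boundary nodes and
  points outside the graph) vanish on all vectors used, so they do not affect linear
  independence.  The choice operator only picks an orientation of an edge between two
  interior vertices, which changes the vector by a sign.
\<close>
definition edge_vector :: "'v::finite set \<Rightarrow> ('v \<Rightarrow> real) \<Rightarrow> 'v set \<Rightarrow> real ^ 'v option" where
  "edge_vector B u e =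
     (SOME w. \<exists>i j. e = {i, j} \<and> i \<noteq> j \<and> i \<notin> B \<and>
        w = axis (Some i) 1 - (if j \<in> B then u j *\<^sub>R axis None 1 else axis (Some j) 1))"

lemma edge_vector_boundary:
  assumes "i \<notin> B" "j \<in> B"
  shows "edge_vector B u {i, j} = axis (Some i) 1 - u j *\<^sub>R axis None 1"
  unfolding edge_vector_def using assms
  by (intro some_equality) (auto simp: doubleton_eq_iff)

lemma edge_vector_interior:
  assumes "i \<notin> B" "j \<notin> B" "i \<noteq> j"
  shows "edge_vector B u {i, j} \<in>
    {axis (Some i) 1 - axis (Some j) 1, axis (Some j) 1 - axis (Some i) 1}"
  unfolding edge_vector_def
proof (rule someI2)
  show "\<exists>i' j'. {i, j} = {i', j'} \<and> i' \<noteq> j' \<and> i' \<notin> B \<and>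
      axis (Some i) 1 - axis (Some j) 1 =
      axis (Some i') 1 - (if j' \<in> B then u j' *\<^sub>R axis None 1 else axis (Some j') (1::real))"
    using assms by (intro exI[of _ i] exI[of _ j]) simp
qed (use assms in \<open>auto simp: doubleton_eq_iff\<close>)

definition dirichlet_vector ::
    "'v::finite set \<Rightarrow> ('v \<Rightarrow> real) \<Rightarrow> 'v set option \<Rightarrow> real ^ 'v option" where
  "dirichlet_vector B u x = (case x of None \<Rightarrow> axis None 1 | Some e \<Rightarrow> edge_vector B u e)"

definition dirichlet_indep ::
    "'v::finite set set \<Rightarrow> 'v set \<Rightarrow> ('v \<Rightarrow> real) \<Rightarrow> 'v set option set \<Rightarrow> bool" where
  "dirichlet_indep E B u = vector_matroid_indep (dirichlet_ground E) (dirichlet_vector B u)"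

lemma matroid_dirichlet: "matroid (dirichlet_ground E) (dirichlet_indep E B u)"
  unfolding dirichlet_indep_def
  by (rule matroid_vector_matroid) (simp add: dirichlet_ground_def)

definition complete_boundary :: "'v set set \<Rightarrow> 'v set \<Rightarrow> 'v set set" where
  "complete_boundary E B = E \<union> {{x, y} | x y. x \<in> B \<and> y \<in> B \<and> x \<noteq> y}"

end

theory Submission
  imports Defs
begin

text \<open>
  Let \<open>n\<close> be the number of interior vertices.  For a set \<open>X\<close> of edges, the corank of
  \<open>X \<union> {e\<^sub>0}\<close> is at most the number of interior components of \<open>X\<close> that no edge of \<open>X\<close> joins
  to the boundary, and \<open>e\<^sub>0\<close> lies in the span of \<open>X\<close> as soon as one interior component is joined
  by \<open>X\<close> to two different boundary nodes.

  If the matroid has a \<open>k\<close>-separation \<open>(X, Y \<union> {e\<^sub>0})\<close> with \<open>k \<le> 2\<close>, there are therefore many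
  components not joined to the boundary.  If the completed graph is 3-connected, each such
  component either contains at least three vertices shared by \<open>X\<close> and \<open>Y\<close>, or is a single edge
  with both ends shared.  Counting shared vertices leaves so little room that one always finds a
  cut by at most two vertices or, using that the interior is connected, that one side is too small.

  Conversely, if the interior is disconnected or the completed graph has a cut \<open>S\<close> of at most two
  vertices, there is a set \<open>A\<close> of interior vertices whose incident edges span a space of dimension
  at most \<open>|A| + 1\<close>, while all other vectors span at most \<open>n - |A| + 1\<close> dimensions, which yields
  a 1- or 2-separation.
\<close>

section \<open>Graph cuts and ranks of vector families\<close>

text \<open>A path from \<open>U\<close> to its complement has a first edge leaving
  \<open>U\<close>. Since edges stay inside \<open>V\<close>, the far end of that edge lies in
  \<open>V - U\<close>.\<close>

lemma connected_graph_cut: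
  assumes "connected_graph V E" "\<And>e. e \<in> E \<Longrightarrow> e \<subseteq> V" "U \<subseteq> V" "U \<noteq> {}" "V - U \<noteq> {}"
  obtains a b where "a \<in> U" "b \<in> V - U" "{a, b} \<in> E"
proof -
  from assms obtain x y where xy: "x \<in> U" "y \<in> V - U" by blast
  with assms(1,3) have "(x, y) \<in> (adj_rel E)\<^sup>*"
    by (auto simp: connected_graph_def)
  moreover have "y \<in> U \<or> (\<exists>a\<in>U. \<exists>b\<in>V - U. {a, b} \<in> E)" if "(x, y) \<in> (adj_rel E)\<^sup>*" for y
    using that
  proof induction
    case (step y z)
    then show ?case using assms(2)[of "{y, z}"] by (auto simp: adj_rel_def)
  qed (use xy in auto)
  ultimately show thesis using xy that by blast
qed

lemma not_connected_graphE:
  assumes "\<not> connected_graph V E" "V \<noteq> {}"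
  obtains U where "U \<subseteq> V" "U \<noteq> {}" "V - U \<noteq> {}" "\<And>a b. a \<in> U \<Longrightarrow> b \<in> V - U \<Longrightarrow> {a, b} \<notin> E"
proof -
  from assms obtain x y where xy: "x \<in> V" "y \<in> V" "(x, y) \<notin> (adj_rel E)\<^sup>*"
    by (auto simp: connected_graph_def)
  show thesis
  proof
    show "{z \<in> V. (x, z) \<in> (adj_rel E)\<^sup>*} \<subseteq> V" by blast
  next
    fix a b assume "a \<in> {z \<in> V. (x, z) \<in> (adj_rel E)\<^sup>*}" "b \<in> V - {z \<in> V. (x, z) \<in> (adj_rel E)\<^sup>*}"
    then show "{a, b} \<notin> E"
      by (auto simp: adj_rel_def dest: rtrancl_into_rtrancl)
  qed (use xy in auto)
qed

lemma matroid_rank_vector_matroid: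
  fixes f :: "'a \<Rightarrow> 'b::euclidean_space"
  assumes "finite ground" "X \<subseteq> ground"
  shows "matroid_rank (vector_matroid_indep ground f) X = dim (f ` X)"
  unfolding matroid_rank_def
proof (rule Max_eqI)
  have "finite X" using assms finite_subset by blast
  then show "finite (card ` {Y. Y \<subseteq> X \<and> vector_matroid_indep ground f Y})"
    by auto
next
  fix c assume "c \<in> card ` {Y. Y \<subseteq> X \<and> vector_matroid_indep ground f Y}"
  then obtain Y where Y: "c = card Y" "Y \<subseteq> X" "inj_on f Y" "independent (f ` Y)"
    by (auto simp: vector_matroid_indep_def)
  have "card (f ` Y) \<le> dim (f ` X)"
    using Y by (intro independent_card_le_dim) auto
  with Y show "c \<le> dim (f ` X)" by (simp add: card_image)
next
  obtain T where T: "T \<subseteq> f ` X" "independent T" "card T = dim (f ` X)"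
    using basis_exists[of "f ` X"] by metis
  then obtain Y where "Y \<subseteq> X" "inj_on f Y" "T = f ` Y"
    by (auto simp: subset_image_inj)
  with T assms show "dim (f ` X) \<in> card ` {Y. Y \<subseteq> X \<and> vector_matroid_indep ground f Y}"
    by (auto simp: vector_matroid_indep_def card_image intro!: image_eqI[of _ card Y])
qed

lemma dim_Un_le_card:
  fixes S T :: "'b::euclidean_space set"
  assumes "finite T"
  shows "dim (S \<union> T) \<le> dim S + card T"
  using assms
proof (induction T)
  case (insert x T)
  then show ?case by (simp add: dim_insert)
qed simp

context network
begin

section \<open>Edges, neighbours and boundary nodes of a network\<close>

lemma finite_V: "finite V"
  using simple by (simp add: simple_graph_def)

lemma edge_subset: "e \<in> E \<Longrightarrow> e \<subseteq> V"
  using simple by (auto simp: simple_graph_def)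

lemma finite_E: "finite E"
  using finite_V edge_subset by (meson PowI finite_Pow_iff finite_subset subsetI)

lemma finite_B: "finite B"
  using boundary_subset finite_V finite_subset by blast

lemma edge_distinct: "{x, y} \<in> E \<Longrightarrow> x \<noteq> y"
  using simple by (auto simp: simple_graph_def)

lemma edge_card: "e \<in> E \<Longrightarrow> card e = 2"
  using simple by (auto simp: simple_graph_def)

lemma edge_other_end:
  assumes "e \<in> E" "v \<in> e"
  obtains y where "e = {v, y}" "y \<noteq> v"
proof -
  from assms(1) have "card e = 2" by (rule edge_card)
  with assms(2) that show thesis by (fastforce simp: card_2_iff)
qed

lemma edge_interior_end:
  assumes "e \<in> E"
  obtains i y where "e = {i, y}" "i \<in> V - B" "y \<in> V" "y \<noteq> i"
proof -
  from assms have "card e = 2" by (rule edge_card)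
  then obtain x y where xy: "e = {x, y}" "x \<noteq> y" by (auto simp: card_2_iff)
  with assms boundary_nonadjacent edge_subset[OF assms] have "x \<notin> B \<or> y \<notin> B" by blast
  with xy edge_subset[OF assms] that[of x y] that[of y x] show thesis by auto
qed

lemma incident_edge:
  assumes "v \<in> V"
  obtains y where "{v, y} \<in> E"
proof -
  have "V \<noteq> {v}" using boundary_subset boundary_card finite_V
    by (metis One_nat_def card.empty card.insert card_mono empty_iff finite.emptyI finite.insertI
        not_less_eq_eq numeral_2_eq_2 psubset_imp_subset)
  with assms have "V - {v} \<noteq> {}" by blast
  with connected_graph_cut[OF connected edge_subset, of "{v}"] assms that show thesis by blast
qed

lemma other_boundary_node:
  obtains j where "j \<in> B" "j \<noteq> a"
proof -
  have "\<not> B \<subseteq> {a}"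
    using boundary_card card_mono[of "{a}" B] by auto
  with that show thesis by blast
qed

lemma interior_nonempty: "V - B \<noteq> {}"
  using boundary_subset by blast

section \<open>Interior components of an edge set\<close>

text \<open>For interior \<open>v\<close> this is the component of \<open>v\<close> in the graph
  that \<open>X\<close> forms on the interior. Edges with a boundary end are dropped, so components
  never merge through a boundary node.\<close>

definition icomp :: "'v set set \<Rightarrow> 'v \<Rightarrow> 'v set" where
  "icomp X v = (adj_rel (delete_vertices X B))\<^sup>* `` {v}"

lemma self_icomp [simp]: "v \<in> icomp X v"
  by (simp add: icomp_def)

lemma icomp_step:
  "x \<in> icomp X v \<Longrightarrow> {x, y} \<in> X \<Longrightarrow> x \<notin> B \<Longrightarrow> y \<notin> B \<Longrightarrow> y \<in> icomp X v"
  by (auto simp: icomp_def adj_rel_def delete_vertices_def intro: rtrancl_into_rtrancl)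

lemma icomp_induct [consumes 1, case_names base step]:
  assumes "w \<in> icomp X v" "P v"
    "\<And>x y. x \<in> icomp X v \<Longrightarrow> P x \<Longrightarrow> {x, y} \<in> X \<Longrightarrow> x \<notin> B \<Longrightarrow> y \<notin> B \<Longrightarrow> P y"
  shows "P w"
proof -
  from assms(1) have "(v, w) \<in> (adj_rel (delete_vertices X B))\<^sup>*" by (simp add: icomp_def)
  then show ?thesis
    by induction (use assms(2,3) in \<open>auto simp: icomp_def adj_rel_def delete_vertices_def\<close>)
qed

lemma icomp_eq:
  assumes "w \<in> icomp X v"
  shows "icomp X w = icomp X v"
proof -
  have "sym (adj_rel (delete_vertices X B))"
    by (auto simp: sym_def adj_rel_def insert_commute)
  then have "sym ((adj_rel (delete_vertices X B))\<^sup>*)" by (rule sym_rtrancl)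
  with assms show ?thesis
    unfolding icomp_def by (auto dest: symD intro: rtrancl_trans)
qed

lemma icomp_disjoint: "icomp X v \<noteq> icomp X w \<Longrightarrow> icomp X v \<inter> icomp X w = {}"
  by (metis disjoint_iff icomp_eq)

lemma icomp_subset:
  assumes "X \<subseteq> E" "v \<in> V - B"
  shows "icomp X v \<subseteq> V - B"
proof
  fix w assume "w \<in> icomp X v"
  then show "w \<in> V - B"
    by (induction rule: icomp_induct) (use assms edge_subset in auto)
qed

definition touched :: "'v set set \<Rightarrow> 'v set \<Rightarrow> bool" where
  "touched X D \<longleftrightarrow> (\<exists>i\<in>D. \<exists>j\<in>B. {i, j} \<in> X)"

text \<open>A vertex met by no edge of \<open>X\<close> is a component by itself and counts here.\<close>
definition free_comps :: "'v set set \<Rightarrow> 'v set set" where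
  "free_comps X = {D \<in> icomp X ` (V - B). \<not> touched X D}"

text \<open>The configuration that forces \<open>e0\<close> into the span of \<open>X\<close>. The
  interior ends \<open>i\<close> and \<open>i'\<close> may coincide.\<close>

definition linked :: "'v set set \<Rightarrow> bool" where
  "linked X \<longleftrightarrow> (\<exists>v\<in>V - B. \<exists>i\<in>icomp X v. \<exists>i'\<in>icomp X v. \<exists>j\<in>B. \<exists>j'\<in>B.
     j \<noteq> j' \<and> {i, j} \<in> X \<and> {i', j'} \<in> X)"

lemma finite_free_comps: "finite (free_comps X)"
  using finite_V by (simp add: free_comps_def)

text \<open>No edge of the whole graph would leave an untouched component, neither to the interior
  nor to the boundary, which contradicts connectivity.\<close>

lemma free_comps_all: "free_comps E = {}"
proof (rule ccontr)
  assume "free_comps E \<noteq> {}"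
  then obtain v where v: "v \<in> V - B" "\<not> touched E (icomp E v)"
    by (auto simp: free_comps_def)
  have "icomp E v \<subseteq> V - B" using v by (intro icomp_subset) auto
  moreover have "B \<noteq> {}" "B \<subseteq> V" using boundary_card boundary_subset by auto
  ultimately obtain a b where ab: "a \<in> icomp E v" "b \<in> V - icomp E v" "{a, b} \<in> E"
    using connected_graph_cut[OF connected edge_subset, of "icomp E v"] self_icomp[of v E] by blast
  with v \<open>icomp E v \<subseteq> V - B\<close> show False
    using icomp_step[of a E v b] by (auto simp: touched_def)
qed

end

section \<open>Ranks in the Dirichlet matroid\<close>

locale dirichlet_network = network V E B
  for V :: "'v::finite set" and E B +
  fixes u :: "'v \<Rightarrow> real"
  assumes inj_u: "inj_on u B"
begin

abbreviation e0 :: "real ^ 'v option" where "e0 \<equiv> axis None 1"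
abbreviation ev :: "'v \<Rightarrow> real ^ 'v option" where "ev i \<equiv> axis (Some i) 1"
abbreviation vecs :: "'v set set \<Rightarrow> (real ^ 'v option) set" where
  "vecs X \<equiv> edge_vector B u ` X"

lemma dirichlet_vector_image:
  "dirichlet_vector B u ` Some ` X = vecs X"
  "dirichlet_vector B u None = e0"
  by (auto simp: dirichlet_vector_def image_image)

lemma rank_dirichlet:
  assumes "Y \<subseteq> dirichlet_ground E"
  shows "matroid_rank (dirichlet_indep E B u) Y = dim (dirichlet_vector B u ` Y)"
  unfolding dirichlet_indep_def
  using assms finite_E by (intro matroid_rank_vector_matroid) (auto simp: dirichlet_ground_def)

lemma interior_diff_in_span:
  assumes "{i, j} \<in> X" "i \<notin> B" "j \<notin> B" "i \<noteq> j"
  shows "ev i - ev j \<in> span (vecs X)"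
proof -
  have "edge_vector B u {i, j} \<in> span (vecs X)"
    using assms(1) by (intro span_base) auto
  then show ?thesis
    using edge_vector_interior[OF assms(2-4), of u] span_neg[of "ev j - ev i" "vecs X"] by auto
qed

lemma boundary_in_span:
  assumes "{i, j} \<in> X" "i \<notin> B" "j \<in> B"
  shows "ev i - u j *\<^sub>R e0 \<in> span (vecs X)"
  using assms edge_vector_boundary[OF assms(2,3), of u] by (metis imageI span_base)

lemma icomp_diff_in_span:
  assumes "X \<subseteq> E" "w \<in> icomp X v"
  shows "ev w - ev v \<in> span (vecs X)"
  using assms(2)
proof (induction rule: icomp_induct)
  case (step x y)
  then have "ev x - ev y \<in> span (vecs X)"
    using assms(1) edge_distinct by (intro interior_diff_in_span) auto
  from span_diff[OF step.IH this] show ?case by simp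
qed (simp add: span_zero)

text \<open>Subtracting the two boundary edge vectors and cancelling along the component leaves
  \<open>(u j - u j') *\<^sub>R e0\<close>, whose coefficient is nonzero by injectivity of
  \<open>u\<close>.\<close>

lemma linked_e0_in_span:
  assumes "X \<subseteq> E" "linked X"
  shows "e0 \<in> span (vecs X)"
proof -
  obtain v i i' j j' where *: "v \<in> V - B" "i \<in> icomp X v" "i' \<in> icomp X v" "j \<in> B" "j' \<in> B"
    "j \<noteq> j'" "{i, j} \<in> X" "{i', j'} \<in> X"
    using assms(2) by (auto simp: linked_def)
  let ?S = "span (vecs X)"
  have "i \<notin> B" "i' \<notin> B" using icomp_subset[OF assms(1) *(1)] *(2,3) by auto
  then have b: "ev i - u j *\<^sub>R e0 \<in> ?S" "ev i' - u j' *\<^sub>R e0 \<in> ?S"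
    using * by (auto intro: boundary_in_span)
  have "ev i - ev i' \<in> ?S"
    using span_diff[OF icomp_diff_in_span[OF assms(1) *(2)] icomp_diff_in_span[OF assms(1) *(3)]]
    by simp
  from span_diff[OF this span_diff[OF b]] have "(u j - u j') *\<^sub>R e0 \<in> ?S"
    by (simp add: algebra_simps)
  then have "(1 / (u j - u j')) *\<^sub>R (u j - u j') *\<^sub>R e0 \<in> ?S" by (rule span_scale)
  moreover have "u j \<noteq> u j'" using inj_u * by (auto dest: inj_onD)
  ultimately show ?thesis by simp
qed

lemma card_coordinates: "finite I \<Longrightarrow> card (insert e0 (ev ` I)) = card I + 1"
  by (subst card_insert_disjoint) (auto simp: axis_eq_axis card_image inj_on_def)

lemma dim_ge_coordinates:
  assumes "e0 \<in> span S" "\<And>i. i \<in> I \<Longrightarrow> ev i \<in> span S"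
  shows "card I + 1 \<le> dim S"
proof -
  have "independent (insert e0 (ev ` I))"
    by (rule independent_mono[OF independent_Basis]) (auto simp: axis_in_Basis_iff)
  then have "card (insert e0 (ev ` I)) \<le> dim (span S)"
    using assms by (intro independent_card_le_dim) auto
  then show ?thesis by (simp add: card_coordinates)
qed

lemma dim_le_coordinates:
  assumes "S \<subseteq> span (insert e0 (ev ` I))"
  shows "dim S \<le> card I + 1"
  using dim_le_card[OF assms] by (simp add: card_coordinates)

lemma edge_vector_in_coordinates:
  assumes "e \<in> E" "e - B \<subseteq> I"
  shows "edge_vector B u e \<in> span (insert e0 (ev ` I))"
proof -
  obtain i y where e: "e = {i, y}" "i \<in> V - B" "y \<in> V" "y \<noteq> i"
    using edge_interior_end[OF assms(1)] by metis
  show ?thesis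
  proof (cases "y \<in> B")
    case True
    with e assms have "ev i \<in> insert e0 (ev ` I)" by auto
    then have "ev i - u y *\<^sub>R e0 \<in> span (insert e0 (ev ` I))"
      by (intro span_diff span_scale; intro span_base) auto
    with True e show ?thesis by (simp add: edge_vector_boundary)
  next
    case False
    have *: "a \<in> I \<Longrightarrow> b \<in> I \<Longrightarrow> ev a - ev b \<in> span (insert e0 (ev ` I))" for a b
      by (intro span_diff; intro span_base) auto
    from False e assms have "i \<in> I" "y \<in> I" by auto
    with * show ?thesis using edge_vector_interior[of i B y u] False e by auto
  qed
qed

lemma dim_coordinates_le:
  assumes "X \<subseteq> E" "\<And>e. e \<in> X \<Longrightarrow> e - B \<subseteq> I"
  shows "dim (insert e0 (vecs X)) \<le> card I + 1"
proof (rule dim_le_coordinates)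
  show "insert e0 (vecs X) \<subseteq> span (insert e0 (ev ` I))"
    using assms edge_vector_in_coordinates span_base[of e0 "insert e0 (ev ` I)"] by auto
qed

text \<open>
  Adjoining one coordinate vector for each free component yields a spanning set.
\<close>
lemma rank_lower_bound:
  assumes X: "X \<subseteq> E"
  shows "card (V - B) + 1 \<le> dim (insert e0 (vecs X)) + card (free_comps X)"
proof -
  define g where "g D = (SOME v. v \<in> D)" for D :: "'v set"
  let ?R = "ev ` g ` free_comps X"
  let ?L = "span (insert e0 (vecs X) \<union> ?R)"
  have sub: "span (vecs X) \<subseteq> ?L" by (intro span_mono) auto
  have "ev v \<in> ?L" if v: "v \<in> V - B" for v
  proof -
    \<comment> \<open>One vertex of the component suffices, because differences of coordinate
      vectors within a component already lie in the span of \<open>X\<close>.\<close>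
    have "\<exists>w\<in>icomp X v. ev w \<in> ?L"
    proof (cases "touched X (icomp X v)")
      case True
      then obtain i j where ij: "i \<in> icomp X v" "j \<in> B" "{i, j} \<in> X" by (auto simp: touched_def)
      with icomp_subset[OF X v] have "ev i - u j *\<^sub>R e0 \<in> ?L"
        using sub boundary_in_span by blast
      moreover have "u j *\<^sub>R e0 \<in> ?L" by (intro span_scale span_base) auto
      ultimately have "ev i - u j *\<^sub>R e0 + u j *\<^sub>R e0 \<in> ?L" by (rule span_add)
      with ij show ?thesis by auto
    next
      case False
      then have "icomp X v \<in> free_comps X" using v by (auto simp: free_comps_def)
      moreover have "g (icomp X v) \<in> icomp X v"
        unfolding g_def by (rule someI[of _ v]) simp
      moreover from calculation have "ev (g (icomp X v)) \<in> ?L" by (intro span_base) auto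
      ultimately show ?thesis by blast
    qed
    then obtain w where w: "w \<in> icomp X v" "ev w \<in> ?L" by blast
    with icomp_diff_in_span[OF X w(1)] sub have "ev w - ev v \<in> ?L" by blast
    from span_diff[OF w(2) this] show ?thesis by simp
  qed
  then have "card (V - B) + 1 \<le> dim (insert e0 (vecs X) \<union> ?R)"
    by (intro dim_ge_coordinates) (auto intro: span_base)
  also have "\<dots> \<le> dim (insert e0 (vecs X)) + card ?R"
    by (intro dim_Un_le_card) auto
  also have "card ?R \<le> card (free_comps X)"
    unfolding image_image by (rule card_image_le[OF finite_free_comps])
  finally show ?thesis by simp
qed

lemma rank_ground: "dim (insert e0 (vecs E)) = card (V - B) + 1"
proof (rule antisym)
  show "dim (insert e0 (vecs E)) \<le> card (V - B) + 1"
    using edge_subset by (intro dim_coordinates_le) auto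
  show "card (V - B) + 1 \<le> dim (insert e0 (vecs E))"
    using rank_lower_bound[of E] by (simp add: free_comps_all)
qed

text \<open>The rank lower bounds for the two edge sets, each taken with \<open>e0\<close>, are
  added. Adjoining \<open>e0\<close> to \<open>X\<close> raises its rank by at most one, and not at
  all if \<open>X\<close> is linked, which accounts for the \<open>of_bool\<close> term.\<close>

lemma separation_bound:
  assumes X: "X \<subseteq> E" and lt: "dim (vecs X) + dim (insert e0 (vecs (E - X))) < card (V - B) + 1 + k"
  shows "card (V - B) + of_bool (linked X) < card (free_comps X) + card (free_comps (E - X)) + k"
proof -
  have "dim (insert e0 (vecs X)) + of_bool (linked X) \<le> dim (vecs X) + 1"
    using linked_e0_in_span[OF X] by (simp add: dim_insert)
  with rank_lower_bound[OF X] rank_lower_bound[of "E - X"] lt show ?thesis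
    by (simp add: Diff_subset)
qed

text \<open>The edges at \<open>A\<close> are separated from all other elements: the latter only
  involve \<open>e0\<close> and the interior coordinates outside \<open>A\<close>. The edge
  \<open>f\<close> together with \<open>e0\<close> makes that side have at least two
  elements.\<close>

lemma separation_of_vertex_set:
  assumes A: "A \<subseteq> V - B" "A \<noteq> {}"
    and dim: "dim (vecs {e \<in> E. e \<inter> A \<noteq> {}}) \<le> card A + 1"
    and f: "f \<in> E" "f \<inter> A = {}"
  shows "\<not> tutte_connected 3 (dirichlet_ground E) (dirichlet_indep E B u)"
proof
  assume conn: "tutte_connected 3 (dirichlet_ground E) (dirichlet_indep E B u)"
  define X where "X = {e \<in> E. e \<inter> A \<noteq> {}}"
  have X: "X \<subseteq> E" by (auto simp: X_def)
  have fin: "finite X" "finite (E - X)" using finite_E X finite_subset by auto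
  let ?X = "Some ` X" and ?Y = "insert None (Some ` (E - X))"
  have cards: "card ?X = card X" "card ?Y = card (E - X) + 1"
    using fin by (simp_all add: card_image)
  have "f \<in> E - X" using f by (auto simp: X_def)
  then have "1 \<le> card (E - X)" using fin by (metis One_nat_def Suc_leI card_gt_0_iff empty_iff)
  obtain v where "v \<in> A" using A by blast
  then obtain y where "{v, y} \<in> E" using incident_edge[of v] A by blast
  with \<open>v \<in> A\<close> have "{v, y} \<in> X" by (auto simp: X_def)
  then have "1 \<le> card X" using fin by (metis One_nat_def Suc_leI card_gt_0_iff empty_iff)
  have cA: "card A \<le> card (V - B)" "card (V - B - A) = card (V - B) - card A" "1 \<le> card A"
    using A finite_V by (auto simp: card_mono card_Diff_subset finite_subset Suc_le_eq card_gt_0_iff)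
  have dY: "dim (insert e0 (vecs (E - X))) \<le> card (V - B - A) + 1"
    using edge_subset by (intro dim_coordinates_le) (auto simp: X_def)
  have no: "\<not> tutte_separation k (dirichlet_ground E) (dirichlet_indep E B u) ?X ?Y" if "k \<in> {1, 2}" for k
    using conn that unfolding tutte_connected_def by auto
  have ranks: "matroid_rank (dirichlet_indep E B u) ?X = dim (vecs X)"
    "matroid_rank (dirichlet_indep E B u) ?Y = dim (insert e0 (vecs (E - X)))"
    "matroid_rank (dirichlet_indep E B u) (dirichlet_ground E) = card (V - B) + 1"
    using X rank_ground
    by (subst rank_dirichlet; auto simp: dirichlet_ground_def dirichlet_vector_image)+
  have parts: "?X \<union> ?Y = dirichlet_ground E" "?X \<inter> ?Y = {}"
    using X by (auto simp: dirichlet_ground_def)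
  show False
  \<comment> \<open>A single edge is too small for a 2-separation, but then its rank is at most 1,
    and \<open>1 \<le> card A\<close> already gives a 1-separation.\<close>
  proof (cases "card X = 1")
    case True
    then have "dim (vecs X) \<le> 1"
      using dim_le_card[of "vecs X" "vecs X"] card_image_le[OF fin(1), of "edge_vector B u"]
      by (simp add: fin span_superset)
    then have "tutte_separation 1 (dirichlet_ground E) (dirichlet_indep E B u) ?X ?Y"
      unfolding tutte_separation_def ranks cards using parts True dY cA by simp
    with no[of 1] show False by simp
  next
    case False
    then have "tutte_separation 2 (dirichlet_ground E) (dirichlet_indep E B u) ?X ?Y"
      unfolding tutte_separation_def ranks cards
      using parts dY cA dim \<open>1 \<le> card X\<close> \<open>1 \<le> card (E - X)\<close> by (simp flip: X_def)
    with no[of 2] show False by simp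
  qed
qed

end

section \<open>Separations of a 3-connected network\<close>

context network
begin

definition isolated :: "'v set set \<Rightarrow> 'v set" where
  "isolated X = {v \<in> V - B. \<forall>e\<in>X. v \<notin> e}"

definition shared :: "'v set set \<Rightarrow> 'v set" where
  "shared X = V - B - isolated X - isolated (E - X)"

definition touched_shared :: "'v set set \<Rightarrow> 'v set" where
  "touched_shared X = {v \<in> shared X. touched X (icomp X v)}"

text \<open>Three is the threshold of 3-connectivity: deleting at most two shared vertices cannot
  cut off the rest of a free component, so such a component is fully shared unless it is a single
  isolated vertex.\<close>

definition big_comps :: "'v set set \<Rightarrow> 'v set set" where
  "big_comps X = {C \<in> free_comps X. 3 \<le> card (C \<inter> shared X)}"

lemma shared_Diff: "X \<subseteq> E \<Longrightarrow> shared (E - X) = shared X"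
  by (auto simp: shared_def double_diff)

lemma finite_shared: "finite (shared X)"
  using finite_V by (simp add: shared_def)

text \<open>Every vertex has an incident edge, so none is isolated in both parts, and the three sets
  partition the interior.\<close>

lemma card_interior:
  assumes "X \<subseteq> E"
  shows "card (V - B) = card (isolated X) + card (isolated (E - X)) + card (shared X)"
proof -
  have disj: "isolated X \<inter> isolated (E - X) = {}"
  proof (rule ccontr)
    assume "\<not> ?thesis"
    then obtain v where v: "v \<in> isolated X" "v \<in> isolated (E - X)" by blast
    then obtain y where "{v, y} \<in> E" using incident_edge[of v] by (auto simp: isolated_def)
    with v show False by (auto simp: isolated_def)
  qed
  have "V - B = isolated X \<union> isolated (E - X) \<union> shared X"
    by (auto simp: shared_def isolated_def)
  moreover have "finite (isolated X)" "finite (isolated (E - X))"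
    using finite_V by (auto simp: isolated_def)
  moreover have "(isolated X \<union> isolated (E - X)) \<inter> shared X = {}"
    by (auto simp: shared_def)
  ultimately show ?thesis
    using disj finite_shared by (simp add: card_Un_disjoint)
qed

lemma icomp_isolated:
  assumes "v \<in> isolated X"
  shows "icomp X v = {v}"
proof -
  have "w = v" if "w \<in> icomp X v" for w
    using that by (induction rule: icomp_induct) (use assms in \<open>auto simp: isolated_def\<close>)
  then show ?thesis by auto
qed

lemma icomp_not_isolated:
  assumes "v \<in> V - B" "v \<notin> isolated X" "w \<in> icomp X v"
  shows "w \<notin> isolated X"
proof
  assume w: "w \<in> isolated X"
  then have "icomp X v = {w}" using icomp_isolated icomp_eq[OF assms(3)] by simp
  with w assms(2) self_icomp[of v X] show False by auto
qed

lemma touched_not_isolated: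
  assumes "touched X (icomp X v)" "w \<in> icomp X v"
  shows "w \<notin> isolated X"
proof
  assume w: "w \<in> isolated X"
  then have "icomp X v = {w}" using icomp_isolated icomp_eq[OF assms(2)] by simp
  with assms(1) w show False by (auto simp: touched_def isolated_def)
qed

text \<open>Such a vertex is isolated in \<open>E - X\<close>, so all its edges belong to
  \<open>X\<close>.\<close>

lemma unshared_edge:
  assumes "x \<in> V - B" "x \<notin> isolated X" "x \<notin> shared X" "{x, y} \<in> E"
  shows "{x, y} \<in> X"
  using assms by (auto simp: shared_def isolated_def)

lemma shared_not_isolated: "v \<in> shared X \<Longrightarrow> v \<in> V - B \<and> v \<notin> isolated X"
  by (auto simp: shared_def)

end

section \<open>Components under 3-connectivity of the completed graph and connectivity of the
  interior\<close>

locale threeconn_network = network V E B for V :: "'v set" and E B +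
  assumes interior_connected: "connected_graph (V - B) (delete_vertices E B)"
    and threeconn: "k_connected_graph 3 V (complete_boundary E B)"
begin

lemma cut_edge:
  assumes "S \<subseteq> V" "card S < 3" "U \<subseteq> V - S" "U \<noteq> {}" "V - S - U \<noteq> {}"
  obtains x y where "x \<in> U" "y \<in> V - S - U" "{x, y} \<in> E \<or> x \<in> B \<and> y \<in> B"
proof -
  have conn: "connected_graph (V - S) (delete_vertices (complete_boundary E B) S)"
    using threeconn assms(1,2) by (simp add: k_connected_graph_def)
  have "e \<subseteq> V - S" if "e \<in> delete_vertices (complete_boundary E B) S" for e
    using that edge_subset boundary_subset by (auto simp: delete_vertices_def complete_boundary_def)
  then obtain x y where xy: "x \<in> U" "y \<in> V - S - U"
      "{x, y} \<in> delete_vertices (complete_boundary E B) S"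
    using connected_graph_cut[OF conn _ assms(3-5)] by metis
  from this(3) have "{x, y} \<in> E \<or> x \<in> B \<and> y \<in> B"
    by (auto simp: delete_vertices_def complete_boundary_def doubleton_eq_iff)
  with xy that show thesis by blast
qed

lemma interior_cut_edge:
  assumes "U \<subseteq> V - B" "U \<noteq> {}" "U \<noteq> V - B"
  obtains x y where "x \<in> U" "y \<in> V - B - U" "{x, y} \<in> E"
proof -
  have "\<And>e. e \<in> delete_vertices E B \<Longrightarrow> e \<subseteq> V - B"
    using edge_subset by (auto simp: delete_vertices_def)
  from connected_graph_cut[OF interior_connected this assms(1,2)] assms(1,3) that
  show thesis by (auto simp: delete_vertices_def)
qed

text \<open>Deleting the at most two neighbours \<open>q\<close> and \<open>a\<close> would isolate
  \<open>p\<close>. As \<open>q\<close> is interior, a boundary node different from \<open>a\<close>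
  survives on the other side.\<close>

lemma interior_degree:
  assumes p: "p \<in> V - B" and q: "q \<in> V - B" "q \<noteq> p" and nbrs: "\<And>y. {p, y} \<in> E \<Longrightarrow> y = q \<or> y = a"
  shows False
proof -
  \<comment> \<open>The intersection is needed because \<open>a\<close> is arbitrary: it may equal
    \<open>p\<close> or lie outside \<open>V\<close>.\<close>
  let ?S = "{q, a} \<inter> (V - {p})"
  obtain j where j: "j \<in> B" "j \<noteq> a" by (rule other_boundary_node)
  have "card ?S \<le> card {q, a}" by (intro card_mono) auto
  also have "\<dots> < 3" by (simp add: card_insert_if)
  finally have "card ?S < 3" .
  moreover have "V - ?S - {p} \<noteq> {}"
  proof -
    have "j \<in> V - ?S - {p}" using j p q boundary_subset by auto
    then show ?thesis by blast
  qed
  moreover have "?S \<subseteq> V" "{p} \<subseteq> V - ?S" "{p} \<noteq> {}" using p by auto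
  ultimately obtain x y where "x \<in> {p}" "y \<in> V - ?S - {p}" "{x, y} \<in> E \<or> x \<in> B \<and> y \<in> B"
    using cut_edge[of ?S "{p}"] by (metis empty_iff)
  with nbrs p edge_subset show False by auto
qed

text \<open>At an unshared vertex of the component all edges lie in \<open>X\<close>, hence stay in
  the component. Deleting the at most two shared vertices would thus separate the unshared ones from
  the boundary, so there are none. Not being isolated, \<open>v\<close> has a neighbour in the
  component, which gives size exactly two.\<close>

lemma free_comp_shared:
  assumes X: "X \<subseteq> E" and v: "v \<in> V - B" "v \<notin> isolated X" and free: "\<not> touched X (icomp X v)"
    and small: "card (icomp X v \<inter> shared X) < 3"
  shows "icomp X v \<subseteq> shared X" "card (icomp X v) = 2"
proof -
  let ?C = "icomp X v"
  have C: "?C \<subseteq> V - B" using X v by (intro icomp_subset)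
  show sub: "?C \<subseteq> shared X"
  proof (rule ccontr)
    assume "\<not> ?C \<subseteq> shared X"
    then have "?C - shared X \<noteq> {}" by blast
    moreover obtain b where "b \<in> B" using other_boundary_node by metis
    with C boundary_subset have "b \<in> V - ?C \<inter> shared X - (?C - shared X)" by blast
    then have "V - ?C \<inter> shared X - (?C - shared X) \<noteq> {}" by blast
    moreover have "?C - shared X \<subseteq> V - ?C \<inter> shared X" "?C \<inter> shared X \<subseteq> V" using C by auto
    ultimately obtain x y where xy: "x \<in> ?C - shared X" "y \<in> V - ?C \<inter> shared X - (?C - shared X)"
        "{x, y} \<in> E \<or> x \<in> B \<and> y \<in> B"
      using cut_edge small by metis
    then have "{x, y} \<in> E" using C by auto
    then have "{x, y} \<in> X"
      using xy C icomp_not_isolated[OF v] by - (rule unshared_edge, blast+)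
    with xy C free show False
      using icomp_step[of x X v y] by (auto simp: touched_def)
  qed
  from v obtain e where "e \<in> X" "v \<in> e" by (auto simp: isolated_def)
  moreover from calculation X obtain y where "e = {v, y}" "y \<noteq> v"
    using edge_other_end by blast
  ultimately have y: "{v, y} \<in> X" "y \<noteq> v" by auto
  with free have "y \<notin> B" by (auto simp: touched_def)
  with y v have "{v, y} \<subseteq> ?C" using icomp_step[of v X v y] by simp
  moreover have fin: "finite ?C" using C finite_V finite_subset by blast
  ultimately have "card {v, y} \<le> card ?C" by (intro card_mono)
  with y(2) sub small show "card ?C = 2" by (simp add: Int_absorb2)
qed

text \<open>
  Every free component other than a single isolated vertex uses up at least two shared vertices
  (three if it is big), and none of these lies in a touched component.
\<close>
lemma count_free_comps:
  assumes X: "X \<subseteq> E"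
  shows "2 * card (free_comps X) + card (touched_shared X) + card (big_comps X)
    \<le> 2 * card (isolated X) + card (shared X)"
proof -
  define F where "F = {C \<in> free_comps X. C \<inter> isolated X = {}}"
  let ?W = "shared X"
  have finF: "finite F" using finite_free_comps by (simp add: F_def)
  have fini: "finite (isolated X)" using finite_V by (simp add: isolated_def)
  \<comment> \<open>A component meeting the isolated vertices is a singleton. The others are
    collected in \<open>F\<close>.\<close>
  have "free_comps X \<subseteq> (\<lambda>v. {v}) ` isolated X \<union> F"
  proof
    fix C assume C: "C \<in> free_comps X"
    then obtain v where v: "C = icomp X v" by (auto simp: free_comps_def)
    show "C \<in> (\<lambda>v. {v}) ` isolated X \<union> F"
    proof (cases "C \<inter> isolated X = {}")
      case False
      then obtain w where "w \<in> icomp X v" "w \<in> isolated X" using v by blast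
      then have "C = {w}" using v icomp_eq[of w X v] icomp_isolated by simp
      with \<open>w \<in> isolated X\<close> show ?thesis by blast
    qed (use C in \<open>simp add: F_def\<close>)
  qed
  then have "card (free_comps X) \<le> card ((\<lambda>v. {v}) ` isolated X \<union> F)"
    using finF fini by (intro card_mono) auto
  also have "\<dots> \<le> card (isolated X) + card F"
    using card_Un_le card_image_le[OF fini] by (meson add_le_mono1 order_trans)
  finally have 1: "card (free_comps X) \<le> card (isolated X) + card F" .
  have size: "2 + of_bool (C \<in> big_comps X) \<le> card (C \<inter> ?W)" if "C \<in> F" for C
  proof (cases "C \<in> big_comps X")
    case False
    from that obtain v where v: "v \<in> V - B" "C = icomp X v" "\<not> touched X C" "C \<inter> isolated X = {}"
      by (auto simp: F_def free_comps_def)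
    moreover from v have "v \<notin> isolated X" using self_icomp[of v X] by blast
    moreover have "card (C \<inter> ?W) < 3" using False that by (auto simp: big_comps_def F_def)
    ultimately have "C \<subseteq> ?W" "card C = 2"
      using free_comp_shared[OF X v(1)] by blast+
    with False show ?thesis by (simp add: Int_absorb2)
  qed (simp add: big_comps_def)
  have bigF: "big_comps X \<subseteq> F"
  proof
    fix C assume "C \<in> big_comps X"
    then obtain v where v: "v \<in> V - B" "C = icomp X v" "C \<in> free_comps X" "3 \<le> card (C \<inter> ?W)"
      by (auto simp: big_comps_def free_comps_def)
    then have "C \<inter> ?W \<noteq> {}" by auto
    then obtain w where "w \<in> C" "w \<notin> isolated X" by (auto simp: shared_def)
    moreover have "v \<notin> isolated X"
      using calculation v(2) icomp_isolated[of v X] by auto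
    ultimately have "C \<inter> isolated X = {}"
      using v icomp_not_isolated[OF v(1)] by blast
    with v show "C \<in> F" by (simp add: F_def)
  qed
  have "2 * card F + card (big_comps X) = (\<Sum>C\<in>F. 2 + of_bool (C \<in> big_comps X))"
    using bigF finF by (simp add: sum.distrib Int_absorb1 del: add_2_eq_Suc add_2_eq_Suc')
  also have "\<dots> \<le> (\<Sum>C\<in>F. card (C \<inter> ?W))" by (intro sum_mono size)
  also have "\<dots> = card (\<Union>C\<in>F. C \<inter> ?W)"
  proof (rule card_UN_disjoint[symmetric])
    show "\<forall>C\<in>F. \<forall>D\<in>F. C \<noteq> D \<longrightarrow> (C \<inter> ?W) \<inter> (D \<inter> ?W) = {}"
    proof (intro ballI impI)
      fix C D assume "C \<in> F" "D \<in> F" "C \<noteq> D"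
      then obtain v w where "C = icomp X v" "D = icomp X w"
        by (auto simp: F_def free_comps_def)
      with \<open>C \<noteq> D\<close> have "C \<inter> D = {}" using icomp_disjoint by simp
      then show "(C \<inter> ?W) \<inter> (D \<inter> ?W) = {}" by blast
    qed
  qed (use finF finite_shared in auto)
  also have "\<dots> + card (touched_shared X) = card ((\<Union>C\<in>F. C \<inter> ?W) \<union> touched_shared X)"
  proof (rule card_Un_disjoint[symmetric])
    have "w \<notin> touched_shared X" if "w \<in> C" "C \<in> F" for w C
    proof -
      from that obtain v where "C = icomp X v" "\<not> touched X C"
        by (auto simp: F_def free_comps_def)
      with that(1) show ?thesis using icomp_eq[of w X v] by (simp add: touched_shared_def)
    qed
    then show "(\<Union>C\<in>F. C \<inter> ?W) \<inter> touched_shared X = {}" by blast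
  qed (use finF finite_shared in \<open>auto simp: touched_shared_def\<close>)
  also have "\<dots> \<le> card ?W"
    using finite_shared by (intro card_mono) (auto simp: touched_shared_def)
  finally show ?thesis using 1 by simp
qed

text \<open>Without a shared vertex all edges at the component lie in \<open>X\<close>. Connectivity
  of the interior then makes the component the whole interior, and every edge has an interior end,
  so \<open>E - X\<close> would be empty.\<close>

lemma touched_meets_shared:
  assumes X: "X \<subseteq> E" "E - X \<noteq> {}" and v: "v \<in> V - B" "touched X (icomp X v)"
  obtains w where "w \<in> icomp X v" "w \<in> touched_shared X" "icomp X w = icomp X v"
proof -
  let ?D = "icomp X v"
  have D: "?D \<subseteq> V - B" using X v by (intro icomp_subset)
  have "?D \<inter> shared X \<noteq> {}"
  proof
    assume none: "?D \<inter> shared X = {}"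
    then have inX: "{x, y} \<in> X" if "x \<in> ?D" "{x, y} \<in> E" for x y
      using that D touched_not_isolated[OF v(2)] by - (rule unshared_edge, blast+)
    have "?D = V - B"
    proof (rule ccontr)
      assume "?D \<noteq> V - B"
      then obtain x y where "x \<in> ?D" "y \<in> V - B - ?D" "{x, y} \<in> E"
        using interior_cut_edge[OF D] self_icomp by (metis empty_iff)
      with inX D show False using icomp_step[of x X v y] by blast
    qed
    with inX have "E \<subseteq> X" using edge_interior_end by (metis subsetI)
    with X show False by blast
  qed
  then obtain w where "w \<in> ?D" "w \<in> shared X" by blast
  with that[OF _ _ icomp_eq] v(2) show thesis by (simp add: icomp_eq touched_shared_def)
qed

text \<open>The component can be left only through its one shared vertex \<open>w\<close> or its one
  boundary neighbour \<open>j\<close>. Deleting both would cut its remaining vertices off from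
  another boundary node.\<close>

lemma touched_once_singleton:
  assumes X: "X \<subseteq> E" and v: "v \<in> V - B" "touched X (icomp X v)"
    and shared: "icomp X v \<inter> shared X = {w}"
    and once: "\<And>i y. i \<in> icomp X v \<Longrightarrow> y \<in> B \<Longrightarrow> {i, y} \<in> X \<Longrightarrow> y = j"
  shows "icomp X v = {w}"
proof (rule ccontr)
  let ?D = "icomp X v"
  assume neq: "?D \<noteq> {w}"
  have D: "?D \<subseteq> V - B" using X v by (intro icomp_subset)
  have w: "w \<in> ?D" using shared by auto
  obtain b where b: "b \<in> B" "b \<noteq> j" by (rule other_boundary_node)
  have j: "j \<in> B" using v(2) once by (auto simp: touched_def)
  have S: "{j, w} \<subseteq> V" "card {j, w} < 3"
    using j w D boundary_subset by (auto simp: card_insert_if)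
  have U: "?D - {w} \<subseteq> V - {j, w}" using D j by auto
  have U1: "?D - {w} \<noteq> {}" using neq w by blast
  have "b \<in> V - {j, w} - (?D - {w})" using b w D boundary_subset by auto
  then have "V - {j, w} - (?D - {w}) \<noteq> {}" by blast
  then obtain x y where xy: "x \<in> ?D - {w}" "y \<in> V - {j, w} - (?D - {w})" "{x, y} \<in> E \<or> x \<in> B \<and> y \<in> B"
    using cut_edge[OF S U U1] by metis
  then have "{x, y} \<in> E" using D by auto
  moreover have "x \<notin> shared X" using xy shared by auto
  ultimately have "{x, y} \<in> X"
    using xy D touched_not_isolated[OF v(2)] by - (rule unshared_edge, blast+)
  with xy D once[of x y] show False
    using icomp_step[of x X v y] by auto
qed

text \<open>The component has just two vertices and no edge to the boundary, so \<open>p\<close> has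
  at most one neighbour along \<open>X\<close>.\<close>

lemma free_pair:
  assumes X: "X \<subseteq> E" and p: "p \<in> shared X" "\<not> touched X (icomp X p)" and small: "big_comps X = {}"
  obtains q where "icomp X p = {p, q}" "q \<noteq> p" "q \<in> V - B" "\<And>y. {p, y} \<in> X \<Longrightarrow> y = q"
proof -
  have pi: "p \<in> V - B" "p \<notin> isolated X" using p by (auto simp: shared_def)
  then have "icomp X p \<in> free_comps X" using p by (auto simp: free_comps_def)
  with small have "card (icomp X p \<inter> shared X) < 3" by (auto simp: big_comps_def)
  then have "card (icomp X p) = 2" using free_comp_shared(2)[OF X pi p(2)] by simp
  then obtain a b where ab: "icomp X p = {a, b}" "a \<noteq> b" by (auto simp: card_2_iff)
  with self_icomp[of p X] have "p = a \<or> p = b" by simp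
  with ab obtain q where q: "icomp X p = {p, q}" "q \<noteq> p" by blast
  show thesis
  proof (rule that[OF q])
    show "q \<in> V - B" using icomp_subset[OF X pi(1)] q by auto
  next
    fix y assume y: "{p, y} \<in> X"
    then have "y \<notin> B" "y \<noteq> p" using p X edge_distinct[of p y] by (auto simp: touched_def)
    with y pi icomp_step[of p X p y] q show "y = q" by auto
  qed
qed

text \<open>If \<open>p\<close> lay in free components on both sides, it would have at most one edge
  in each part, against the lower bound of three on interior degrees.\<close>

lemma shared_touched:
  assumes X: "X \<subseteq> E" and "big_comps X = {}" "big_comps (E - X) = {}" and p: "p \<in> shared X"
  shows "p \<in> touched_shared X \<union> touched_shared (E - X)"
proof (rule ccontr)
  assume "p \<notin> touched_shared X \<union> touched_shared (E - X)"
  with p X have p': "p \<in> shared (E - X)" "\<not> touched X (icomp X p)" "\<not> touched (E - X) (icomp (E - X) p)"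
    by (auto simp: touched_shared_def shared_Diff)
  obtain q where q: "q \<noteq> p" "q \<in> V - B" "\<And>y. {p, y} \<in> X \<Longrightarrow> y = q"
    using free_pair[OF X p p'(2) assms(2)] by metis
  obtain a where a: "\<And>y. {p, y} \<in> E - X \<Longrightarrow> y = a"
    using free_pair[OF Diff_subset p'(1,3) assms(3)] by metis
  show False
    by (rule interior_degree[of p q a]) (use q a p in \<open>auto simp: shared_def\<close>)
qed

text \<open>Both ends of \<open>e\<close> lie in a free component that is not big, hence they are
  shared. They are not touched through \<open>X\<close>, so they must be touched through
  \<open>E - X\<close>.\<close>

lemma free_edge_touched:
  assumes X: "X \<subseteq> E" and small: "big_comps X = {}" "big_comps (E - X) = {}"
    and e: "e \<in> X" "p \<in> e" "p \<in> V - B" and free: "\<not> touched X (icomp X p)"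
  shows "e \<subseteq> touched_shared (E - X)"
proof -
  have pi: "p \<notin> isolated X" using e by (auto simp: isolated_def)
  have "icomp X p \<in> free_comps X" using e free by (auto simp: free_comps_def)
  with small have "card (icomp X p \<inter> shared X) < 3" by (auto simp: big_comps_def)
  then have sub: "icomp X p \<subseteq> shared X" using free_comp_shared(1)[OF X e(3) pi free] by simp
  have "e \<subseteq> icomp X p"
  proof
    fix y assume y: "y \<in> e"
    show "y \<in> icomp X p"
    proof (cases "y = p")
      case False
      from e X obtain z where "e = {p, z}" using edge_other_end by blast
      with False y have "e = {p, y}" by auto
      with e free have "y \<notin> B" by (auto simp: touched_def)
      with e \<open>e = {p, y}\<close> show ?thesis using icomp_step[of p X p y] by simp
    qed simp
  qed
  moreover have "w \<in> touched_shared (E - X)" if "w \<in> icomp X p" for w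
  proof -
    have "w \<notin> touched_shared X"
      using free icomp_eq[OF that] by (simp add: touched_shared_def)
    with shared_touched[OF X small, of w] that sub show ?thesis by auto
  qed
  ultimately show ?thesis by blast
qed

text \<open>The interior is a single component, and each of two distinct boundary nodes has a
  neighbour in it.\<close>

lemma linked_all: "linked E"
proof -
  obtain j where j: "j \<in> B" by (rule other_boundary_node)
  obtain j' where j': "j' \<in> B" "j' \<noteq> j" by (rule other_boundary_node)
  obtain i where i: "{j, i} \<in> E" using incident_edge[of j] j boundary_subset by blast
  obtain i' where i': "{j', i'} \<in> E" using incident_edge[of j'] j' boundary_subset by blast
  have int: "i \<in> V - B" "i' \<in> V - B"
    using i i' j j' boundary_nonadjacent edge_subset by blast+
  have C: "icomp E i \<subseteq> V - B" using int by (intro icomp_subset) auto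
  have "icomp E i = V - B"
  proof (rule ccontr)
    assume "icomp E i \<noteq> V - B"
    then obtain x y where "x \<in> icomp E i" "y \<in> V - B - icomp E i" "{x, y} \<in> E"
      using interior_cut_edge[OF C] self_icomp by (metis empty_iff)
    with C show False using icomp_step[of x E i y] by blast
  qed
  with int have "i' \<in> icomp E i" by simp
  moreover have "{i, j} \<in> E" "{i', j'} \<in> E" using i i' by (simp_all add: insert_commute)
  ultimately show ?thesis
    unfolding linked_def using int j j' self_icomp by metis
qed

lemma touched_sharedI:
  "x \<in> icomp X v \<Longrightarrow> touched X (icomp X v) \<Longrightarrow> x \<in> shared X \<Longrightarrow> x \<in> touched_shared X"
  by (simp add: touched_shared_def icomp_eq)

lemma finite_touched_shared: "finite (touched_shared X)"
  using finite_shared by (simp add: touched_shared_def)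

lemma unlinked_once:
  assumes "\<not> linked X" "v \<in> V - B" "i \<in> icomp X v" "{i, j} \<in> X" "j \<in> B"
    "i' \<in> icomp X v" "{i', j'} \<in> X" "j' \<in> B"
  shows "j' = j"
  using assms unfolding linked_def by blast

text \<open>Counting leaves a budget of at most two for touched shared vertices and big components.
  The cases depend on which of the two parts has edges to the boundary; each ends with an interior
  vertex of degree two, a cut by one vertex, or a violated cardinality bound.\<close>

lemma no_small_separation:
  assumes X: "X \<subseteq> E" and k: "k \<in> {1, 2}" "k \<le> card X" "k \<le> card (E - X) + 1"
    and lt: "card (V - B) + of_bool (linked X) < card (free_comps X) + card (free_comps (E - X)) + k"
  shows False
proof -
  define Y where "Y = E - X"
  have Y: "Y \<subseteq> E" "E - Y = X" "E - X = Y" using X by (auto simp: Y_def)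
  have sh: "shared Y = shared X" using shared_Diff[OF X] by (simp add: Y)
  let ?tX = "card (touched_shared X)" and ?tY = "card (touched_shared Y)"
  \<comment> \<open>The counts for both parts are added: isolated and shared vertices combine to
    twice the interior, which is compared with twice the assumed inequality.\<close>
  have sum: "?tX + ?tY + card (big_comps X) + card (big_comps Y) + 2 * of_bool (linked X) + 2 \<le> 2 * k"
    using count_free_comps[OF X] count_free_comps[OF Y(1)] card_interior[OF X] lt
    by (simp add: Y sh)
  have finbig: "finite (big_comps Z)" for Z
    using finite_free_comps by (simp add: big_comps_def)
  have Xne: "X \<noteq> {}" using k by auto
  have Yne: "Y \<noteq> {}"
  proof
    assume "Y = {}"
    then have "X = E" "k = 1" using X k by (auto simp: Y_def)
    with sum linked_all show False by simp
  qed
  have meetX: thesis if "v \<in> V - B" "touched X (icomp X v)"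
    "\<And>w. w \<in> icomp X v \<Longrightarrow> w \<in> touched_shared X \<Longrightarrow> icomp X w = icomp X v \<Longrightarrow> thesis" for v thesis
    using touched_meets_shared[OF X _ that(1,2)] that(3) Yne Y by metis
  have meetY: thesis if "v \<in> V - B" "touched Y (icomp Y v)"
    "\<And>w. w \<in> icomp Y v \<Longrightarrow> w \<in> touched_shared Y \<Longrightarrow> icomp Y w = icomp Y v \<Longrightarrow> thesis" for v thesis
    using touched_meets_shared[OF Y(1) _ that(1,2)] that(3) Xne Y by metis
  have posX: "1 \<le> ?tX" if "v \<in> V - B" "touched X (icomp X v)" for v
    using meetX[OF that] finite_touched_shared by (metis One_nat_def Suc_leI card_gt_0_iff empty_iff)
  have posY: "1 \<le> ?tY" if "v \<in> V - B" "touched Y (icomp Y v)" for v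
    using meetY[OF that] finite_touched_shared by (metis One_nat_def Suc_leI card_gt_0_iff empty_iff)
  \<comment> \<open>Linkedness uses up the whole budget, while a linked component also contains a
    touched shared vertex.\<close>
  have nlink: "\<not> linked X"
  proof
    assume l: "linked X"
    then obtain v where "v \<in> V - B" "touched X (icomp X v)"
      unfolding linked_def touched_def by blast
    with posX sum l k show False by fastforce
  qed
  have bd: "\<exists>i\<in>V - B. {i, j} \<in> E" if "j \<in> B" for j
  proof -
    from that boundary_subset have "j \<in> V" by blast
    then obtain i where "{j, i} \<in> E" using incident_edge by blast
    with that boundary_nonadjacent edge_subset show ?thesis
      by (intro bexI[of _ i]) (auto simp: insert_commute)
  qed
  have tXY: "{i, j} \<in> X \<and> touched X (icomp X i) \<or> {i, j} \<in> Y \<and> touched Y (icomp Y i)"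
    if "{i, j} \<in> E" "j \<in> B" for i j
  proof -
    have "{i, j} \<in> X \<or> {i, j} \<in> Y" using that by (auto simp: Y_def)
    with that self_icomp show ?thesis unfolding touched_def by blast
  qed
  \<comment> \<open>Some edge reaches the boundary, and its component contains a touched shared
    vertex. This excludes \<open>k = 1\<close>.\<close>
  have "1 \<le> ?tX + ?tY"
  proof -
    obtain j where "j \<in> B" by (rule other_boundary_node)
    then obtain i where "i \<in> V - B" "{i, j} \<in> E" using bd by blast
    with tXY[of i j] posX posY \<open>j \<in> B\<close> show ?thesis by (meson trans_le_add1 trans_le_add2)
  qed
  with sum k have k2: "k = 2" by auto
  with sum have sum2: "?tX + ?tY + card (big_comps X) + card (big_comps Y) \<le> 2" by simp
  have cX: "2 \<le> card X" using k k2 by simp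
  \<comment> \<open>As \<open>X\<close> is not linked, a touched component has only one boundary
    neighbour. With a single shared vertex \<open>w\<close> it therefore shrinks to
    \<open>w\<close>, whose only edge in \<open>X\<close> goes to that neighbour.\<close>
  have once: thesis
    if h: "v \<in> V - B" "touched X (icomp X v)" "icomp X v \<inter> shared X = {w}"
      and res: "\<And>j. icomp X v = {w} \<Longrightarrow> j \<in> B \<Longrightarrow> {w, j} \<in> X \<Longrightarrow> (\<And>y. {w, y} \<in> X \<Longrightarrow> y = j) \<Longrightarrow> thesis"
    for v w thesis
  proof -
    obtain i j where ij: "i \<in> icomp X v" "j \<in> B" "{i, j} \<in> X"
      using h(2) by (auto simp: touched_def)
    have j: "y = j" if "i' \<in> icomp X v" "y \<in> B" "{i', y} \<in> X" for i' y
      using unlinked_once[OF nlink \<open>v \<in> V - B\<close> ij(1,3,2)] that by blast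
    have D: "icomp X v = {w}" by (rule touched_once_singleton[OF X h j])
    have wB: "w \<notin> B" using D icomp_subset[OF X h(1)] by blast
    have uniq: "y = j" if "{w, y} \<in> X" for y
    proof (cases "y \<in> B")
      case True
      with j[of w y] D that show ?thesis by simp
    next
      case False
      with D wB that icomp_step[of w X v y] have "y = w" by simp
      with that X edge_distinct[of w y] show ?thesis by auto
    qed
    from ij D have "{w, j} \<in> X" by simp
    from res[OF D ij(2) this uniq] show thesis .
  qed
  show False
  proof (cases "\<exists>v\<in>V - B. touched X (icomp X v)")
    case True
    then obtain v where v: "v \<in> V - B" "touched X (icomp X v)" by blast
    show False
    proof (cases "\<exists>v\<in>V - B. touched Y (icomp Y v)")
      case True
      \<comment> \<open>Both parts reach the boundary and exhaust the budget. The touched part of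
        \<open>X\<close> is one edge, so a further edge of \<open>X\<close> lies in a free component
        and has both ends among the touched shared vertices of \<open>Y\<close>, of which there is
        only one.\<close>
      then have t: "?tX = 1" "?tY = 1" using posX[OF v] posY sum2 by fastforce+
      then have big: "big_comps X = {}" "big_comps Y = {}" using sum2 finbig by auto
      obtain w where w: "touched_shared X = {w}" using t(1) by (auto simp: card_1_singleton_iff)
      have wv: "w \<in> icomp X v" using meetX[OF v] w by (metis singletonD)
      have "icomp X v \<inter> shared X = {w}"
        using touched_sharedI[of _ X v] v(2) w wv by (auto simp: touched_shared_def)
      then obtain j where j: "icomp X v = {w}" "{w, j} \<in> X" "\<And>y. {w, y} \<in> X \<Longrightarrow> y = j"
        using once[OF v] by metis
      have "\<not> X \<subseteq> {{w, j}}" using cX card_mono[of "{{w, j}}" X] by auto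
      then obtain e where e: "e \<in> X" "e \<noteq> {w, j}" by blast
      then obtain p y where p: "e = {p, y}" "p \<in> V - B" using X edge_interior_end by blast
      have "\<not> touched X (icomp X p)"
      proof
        assume "touched X (icomp X p)"
        from meetX[OF p(2) this] w have "icomp X p = icomp X w" by (metis singletonD)
        also have "\<dots> = icomp X v" using wv by (rule icomp_eq)
        finally have "p = w" using self_icomp[of p X] j by simp
        with e p j(3)[of y] show False by simp
      qed
      then have "e \<subseteq> touched_shared Y"
        using free_edge_touched[OF X big(1), of e p] big e p by (simp add: Y)
      then have "card e \<le> ?tY" using finite_touched_shared by (intro card_mono)
      with t edge_card[of e] e X show False by auto
    next
      case False
      \<comment> \<open>All boundary edges lie in \<open>X\<close>. Two boundary nodes give two
        different touched components and use up the budget, so \<open>w1\<close> has at most one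
        neighbour along each part.\<close>
      have inX: "{i, j} \<in> X" "touched X (icomp X i)" if "i \<in> V - B" "{i, j} \<in> E" "j \<in> B" for i j
        using tXY[OF that(2,3)] False that(1) by blast+
      obtain j1 where j1: "j1 \<in> B" by (rule other_boundary_node)
      obtain j2 where j2: "j2 \<in> B" "j2 \<noteq> j1" by (rule other_boundary_node)
      obtain i1 where i1: "i1 \<in> V - B" "{i1, j1} \<in> E" using bd j1 by blast
      obtain i2 where i2: "i2 \<in> V - B" "{i2, j2} \<in> E" using bd j2 by blast
      have x1: "{i1, j1} \<in> X" "touched X (icomp X i1)" using inX[OF i1 j1] by auto
      have x2: "{i2, j2} \<in> X" "touched X (icomp X i2)" using inX[OF i2 j2(1)] by auto
      have "i2 \<notin> icomp X i1"
        using unlinked_once[OF nlink i1(1) self_icomp x1(1) j1 _ x2(1) j2(1)] j2(2) by blast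
      then have neq: "icomp X i1 \<noteq> icomp X i2" using self_icomp[of i2 X] by auto
      obtain w1 where w1: "w1 \<in> icomp X i1" "w1 \<in> touched_shared X"
        using meetX[OF i1(1) x1(2)] by metis
      obtain w2 where w2: "w2 \<in> icomp X i2" "w2 \<in> touched_shared X"
        using meetX[OF i2(1) x2(2)] by metis
      have w21: "w2 \<notin> icomp X i1" using icomp_disjoint[OF neq] w2 by blast
      then have "w1 \<noteq> w2" using w1 by blast
      then have c2: "card {w1, w2} = 2" by simp
      have sub: "{w1, w2} \<subseteq> touched_shared X" using w1 w2 by simp
      have "2 \<le> ?tX" using card_mono[OF finite_touched_shared sub] c2 by simp
      with sum2 have t: "?tX = 2" and "card (big_comps Y) = 0" by linarith+
      then have big: "big_comps Y = {}" using finbig by simp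
      have T: "touched_shared X = {w1, w2}"
        using card_subset_eq[OF finite_touched_shared sub] c2 t by simp
      have "icomp X i1 \<inter> shared X = {w1}"
        using touched_sharedI[of _ X i1] x1(2) T w1 w21 by (auto simp: touched_shared_def)
      then obtain j where j: "\<And>y. {w1, y} \<in> X \<Longrightarrow> y = j"
        using once[OF i1(1) x1(2)] by metis
      have "w1 \<in> shared X" using w1 by (simp add: touched_shared_def)
      then have "w1 \<in> shared Y" "w1 \<in> V - B" using sh shared_not_isolated by blast+
      moreover from this have "\<not> touched Y (icomp Y w1)" using False by blast
      ultimately obtain q where q: "q \<noteq> w1" "q \<in> V - B" "\<And>y. {w1, y} \<in> Y \<Longrightarrow> y = q"
        using free_pair[OF Y(1) _ _ big] by metis
      show False
        by (rule interior_degree[of w1 q j]) (use q j \<open>w1 \<in> V - B\<close> in \<open>auto simp: Y_def\<close>)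
    qed
  next
    case False
    \<comment> \<open>All boundary edges lie in \<open>Y\<close>, and every component of
      \<open>X\<close> is free.\<close>
    have bdY: "{i, j} \<in> Y" "touched Y (icomp Y i)" if "i \<in> V - B" "{i, j} \<in> E" "j \<in> B" for i j
      using tXY[OF that(2,3)] False that(1) by blast+
    have "?tX = 0" using False finite_touched_shared
      by (auto simp: touched_shared_def shared_def)
    with \<open>1 \<le> ?tX + ?tY\<close> sum2
    have "?tY = 1 \<or> ?tY = 2 \<and> card (big_comps X) = 0 \<and> card (big_comps Y) = 0" by linarith
    then consider "?tY = 1" | "?tY = 2" "big_comps X = {}" "big_comps Y = {}"
      using finbig by auto
    then show False
    proof cases
      case 1
      then obtain w where w: "touched_shared Y = {w}" by (auto simp: card_1_singleton_iff)
      then have wt: "touched Y (icomp Y w)" "w \<in> V - B"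
        by (auto simp: touched_shared_def shared_def)
      have D: "icomp Y w \<subseteq> V - B" using Y wt by (intro icomp_subset)
      have all: "icomp Y v = icomp Y w" if "v \<in> V - B" "touched Y (icomp Y v)" for v
        using meetY[OF that] w by (metis singletonD)
      obtain e where "e \<in> X" using Xne by blast
      then obtain p y where p: "e = {p, y}" "p \<in> V - B" using X edge_interior_end by blast
      with \<open>e \<in> X\<close> have pi: "p \<notin> isolated X" by (auto simp: isolated_def)
      have pf: "\<not> touched X (icomp X p)" using False p by blast
      \<comment> \<open>The free component of an edge of \<open>X\<close> has at least two shared
        vertices. One of them, \<open>p'\<close>, differs from \<open>w\<close> and lies outside the
        only touched component of \<open>Y\<close>.\<close>
      have "\<not> icomp X p \<inter> shared X \<subseteq> {w}"
      proof
        assume sub: "icomp X p \<inter> shared X \<subseteq> {w}"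
        then have "card (icomp X p \<inter> shared X) \<le> card {w}" by (intro card_mono) auto
        then have le: "card (icomp X p \<inter> shared X) \<le> 1" by simp
        then have "card (icomp X p) = 2" "icomp X p \<subseteq> shared X"
          using free_comp_shared[OF X p(2) pi pf] by auto
        with le show False by (simp add: Int_absorb2)
      qed
      then obtain p' where p': "p' \<in> shared X" "p' \<noteq> w" by blast
      have "p' \<notin> icomp Y w"
        using touched_sharedI[of p' Y w] wt w p' sh by auto
      then have ne: "V - {w} - (B \<union> icomp Y w - {w}) \<noteq> {}"
        using p' by (auto simp: shared_def)
      \<comment> \<open>Deleting \<open>w\<close> alone should separate \<open>p'\<close> from the
        boundary together with the touched component of \<open>Y\<close>. Any edge leaving that set
        lies in \<open>Y\<close>, so its other end would be in the touched component too.\<close>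
      have S: "{w} \<subseteq> V" "card {w} < 3" "B \<union> icomp Y w - {w} \<subseteq> V - {w}"
        using wt D boundary_subset by auto
      have "B \<union> icomp Y w - {w} \<noteq> {}" using other_boundary_node[of w] by blast
      from cut_edge[OF S this ne] obtain x z where xz: "x \<in> B \<union> icomp Y w - {w}"
          "z \<in> V - B - icomp Y w" "z \<noteq> w" "{x, z} \<in> E"
        by blast
      show False
      proof (cases "x \<in> B")
        case True
        then have "touched Y (icomp Y z)" using bdY[of z x] xz by (auto simp: insert_commute)
        from all[OF _ this] xz self_icomp[of z Y] show False by auto
      next
        case xB: False
        then have x: "x \<in> icomp Y w" "x \<in> V - B" using xz D by auto
        then have "x \<notin> shared Y" using touched_sharedI[of x Y w] wt w xz by auto
        then have "{x, z} \<in> Y"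
          using unshared_edge[of x Y z] x touched_not_isolated[OF wt(1) x(1)] xz by simp
        with x xz icomp_step[of x Y w z] show False by auto
      qed
    next
      case 2
      \<comment> \<open>Every edge of \<open>X\<close> has both ends in a two-element set, so
        \<open>X\<close> contains at most one edge.\<close>
      have eq: "e = touched_shared Y" if e: "e \<in> X" for e
      proof -
        obtain p y where p: "e = {p, y}" "p \<in> V - B" using X e edge_interior_end by blast
        then have "e \<subseteq> touched_shared Y"
          using free_edge_touched[OF X 2(2), of e p] 2 that False by (simp add: Y)
        moreover have "card e = 2" using that X edge_card by blast
        ultimately show ?thesis using 2 card_subset_eq[OF finite_touched_shared] by simp
      qed
      then have "X \<subseteq> {touched_shared Y}" by blast
      then have "card X \<le> card {touched_shared Y}" by (intro card_mono) auto
      with cX show False by simp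
    qed
  qed
qed

end

section \<open>Separations from vertex cuts\<close>

lemma not_k_connected_graphE:
  assumes "\<not> k_connected_graph k V E"
  obtains S where "S \<subseteq> V" "card S < k" "\<not> connected_graph (V - S) (delete_vertices E S)"
  using assms by (auto simp: k_connected_graph_def)

context dirichlet_network
begin

lemma edge_outside:
  assumes "v \<in> V - A" "A \<subseteq> V - B" and "\<And>a. a \<in> A \<Longrightarrow> {a, v} \<notin> E"
  obtains f where "f \<in> E" "f \<inter> A = {}"
proof -
  obtain y where y: "{v, y} \<in> E" using incident_edge[of v] assms(1) by blast
  with assms(3)[of y] have "y \<notin> A" by (auto simp: insert_commute)
  with y assms(1) that[of "{v, y}"] show thesis by blast
qed

text \<open>If \<open>A\<close> is one side of a split interior, edges at \<open>A\<close> end in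
  \<open>A\<close> or on the boundary, so their vectors only involve the coordinates of
  \<open>A\<close> and \<open>e0\<close>.\<close>

lemma interior_connected_if_tutte:
  assumes "tutte_connected 3 (dirichlet_ground E) (dirichlet_indep E B u)"
  shows "connected_graph (V - B) (delete_vertices E B)"
proof (rule ccontr)
  assume "\<not> ?thesis"
  then obtain A where A: "A \<subseteq> V - B" "A \<noteq> {}" "V - B - A \<noteq> {}"
      "\<And>a b. a \<in> A \<Longrightarrow> b \<in> V - B - A \<Longrightarrow> {a, b} \<notin> delete_vertices E B"
    using not_connected_graphE[OF _ interior_nonempty] by metis
  then have no: "{a, b} \<notin> E" if "a \<in> A" "b \<in> V - B - A" for a b
    using that A(1) A(4)[OF that] by (auto simp: delete_vertices_def)
  obtain v where "v \<in> V - B - A" using A by blast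
  then obtain f where f: "f \<in> E" "f \<inter> A = {}"
    using edge_outside[of v A] A(1) no by blast
  have "e - B \<subseteq> A" if e: "e \<in> E" "e \<inter> A \<noteq> {}" for e
  proof -
    obtain a where a: "a \<in> e" "a \<in> A" using e by blast
    then obtain y where y: "e = {a, y}" using edge_other_end[OF e(1)] by blast
    with e edge_subset[OF e(1)] no[OF a(2), of y] a show ?thesis by blast
  qed
  then have "dim (insert e0 (vecs {e \<in> E. e \<inter> A \<noteq> {}})) \<le> card A + 1"
    by (intro dim_coordinates_le) auto
  moreover have "dim (vecs {e \<in> E. e \<inter> A \<noteq> {}}) \<le> dim (insert e0 (vecs {e \<in> E. e \<inter> A \<noteq> {}}))"
    by (intro dim_subset) auto
  ultimately have "\<not> tutte_connected 3 (dirichlet_ground E) (dirichlet_indep E B u)"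
    using A(1,2) f by (intro separation_of_vertex_set) auto
  with assms show False by simp
qed

lemma dim_le_translated:
  assumes "finite I" and q: "\<And>e. e \<in> X \<Longrightarrow> edge_vector B u e \<in> span ((\<lambda>i. ev i - q) ` I)"
  shows "dim (vecs X) \<le> card I"
proof -
  have "dim (vecs X) \<le> card ((\<lambda>i. ev i - q) ` I)"
    using assms by (intro dim_le_card) auto
  also have "\<dots> \<le> card I" using assms(1) by (rule card_image_le)
  finally show ?thesis .
qed

text \<open>The common shift \<open>q\<close> cancels in differences, so it may be chosen
  freely.\<close>

lemma interior_edge_in_translated:
  assumes "i \<in> I" "j \<in> I" "i \<noteq> j" "i \<notin> B" "j \<notin> B"
  shows "edge_vector B u {i, j} \<in> span ((\<lambda>i. ev i - q) ` I)"
proof -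
  let ?L = "span ((\<lambda>i. ev i - q) ` I)"
  have "ev a - ev b \<in> ?L" if "a \<in> I" "b \<in> I" for a b
  proof -
    have "(ev a - q) - (ev b - q) \<in> ?L" using that by (intro span_diff[of "ev a - q" _ "ev b - q"] span_base) auto
    then show ?thesis by simp
  qed
  with edge_vector_interior[of i B j u] assms show ?thesis by auto
qed

text \<open>
  If at most one node \<open>j\<close> of \<open>S\<close> is on the boundary, the edges at \<open>A\<close> lie in the span of the
  differences between coordinate vectors and one fixed vector: \<open>u j *\<^sub>R e0\<close>, or the coordinate
  vector of a vertex in \<open>A\<close> if \<open>S\<close> is interior.  This saves one dimension.
\<close>
lemma dim_separated_set:
  assumes A: "A \<subseteq> V - B" "A \<noteq> {}" and S: "S \<subseteq> V" "card S \<le> 2"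
    and nbrs: "\<And>a y. a \<in> A \<Longrightarrow> {a, y} \<in> E \<Longrightarrow> y \<in> A \<union> S"
  shows "dim (vecs {e \<in> E. e \<inter> A \<noteq> {}}) \<le> card A + 1"
proof -
  define X where "X = {e \<in> E. e \<inter> A \<noteq> {}}"
  have fin: "finite A" "finite S" using A S finite_V by (auto intro: finite_subset)
  have XE: "\<exists>a y. e = {a, y} \<and> a \<in> A \<and> a \<notin> B \<and> y \<noteq> a \<and> y \<in> A \<union> S" if "e \<in> X" for e
  proof -
    from that obtain a where a: "e \<in> E" "a \<in> e" "a \<in> A" by (auto simp: X_def)
    then obtain y where "e = {a, y}" "y \<noteq> a" using edge_other_end by blast
    with a nbrs[of a y] A show ?thesis by blast
  qed
  consider "S \<inter> B = {}" | j where "S \<inter> B = {j}" | "2 \<le> card (S \<inter> B)"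
  proof -
    have "card (S \<inter> B) = 0 \<or> card (S \<inter> B) = 1 \<or> 2 \<le> card (S \<inter> B)" by linarith
    with fin that show thesis by (auto simp: card_1_singleton_iff)
  qed
  then have "dim (vecs X) \<le> card A + 1"
  proof cases
    case 1
    obtain a where a: "a \<in> A" using A by blast
    let ?I = "A \<union> S"
    have sp: "span ((\<lambda>i. ev i - ev a) ` ?I) \<subseteq> span ((\<lambda>i. ev i - ev a) ` (?I - {a}))"
    proof (intro span_minimal subspace_span subsetI)
      fix x assume "x \<in> (\<lambda>i. ev i - ev a) ` ?I"
      then obtain i where "x = ev i - ev a" "i \<in> ?I" by blast
      then show "x \<in> span ((\<lambda>i. ev i - ev a) ` (?I - {a}))"
        by (cases "i = a") (auto simp: span_zero intro!: span_base)
    qed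
    have "dim (vecs X) \<le> card (?I - {a})"
    proof (rule dim_le_translated)
      fix e assume "e \<in> X"
      then obtain b y where "e = {b, y}" "b \<in> A" "b \<notin> B" "y \<noteq> b" "y \<in> ?I" using XE by blast
      moreover from this have "y \<notin> B" using 1 A by blast
      ultimately have "edge_vector B u e \<in> span ((\<lambda>i. ev i - ev a) ` ?I)"
        using interior_edge_in_translated[of b ?I y "ev a"] by auto
      with sp show "edge_vector B u e \<in> span ((\<lambda>i. ev i - ev a) ` (?I - {a}))" by blast
    qed (use fin in simp)
    also have "\<dots> = card ?I - 1" using a fin by (simp add: card_Diff_singleton)
    also have "\<dots> \<le> card A + 1" using card_Un_le[of A S] S(2) by linarith
    finally show ?thesis .
  next
    case (2 j)
    \<comment> \<open>With shift \<open>u j *\<^sub>R e0\<close>, an edge from \<open>A\<close> to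
      \<open>j\<close> is itself a generator, so \<open>j\<close> contributes no index.\<close>
    let ?I = "A \<union> (S - {j})"
    have jB: "j \<in> B" using 2 by blast
    have "dim (vecs X) \<le> card ?I"
    proof (rule dim_le_translated)
      fix e assume "e \<in> X"
      then obtain b y where e: "e = {b, y}" "b \<in> A" "b \<notin> B" "y \<noteq> b" "y \<in> A \<union> S" using XE by blast
      show "edge_vector B u e \<in> span ((\<lambda>i. ev i - u j *\<^sub>R e0) ` ?I)"
      proof (cases "y = j")
        case True
        with e jB show ?thesis by (auto simp: edge_vector_boundary intro!: span_base)
      next
        case False
        with e 2 A have "y \<in> ?I" "y \<notin> B" by blast+
        with e show ?thesis using interior_edge_in_translated[of b ?I y] by auto
      qed
    qed (use fin in simp)
    also have "\<dots> \<le> card A + card (S - {j})" by (rule card_Un_le)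
    also have "\<dots> \<le> card A + 1"
      using 2 S(2) fin by (subst card_Diff_singleton) auto
    finally show ?thesis .
  next
    case 3
    \<comment> \<open>Here all of \<open>S\<close> lies on the boundary, so only the coordinates of
      \<open>A\<close> and \<open>e0\<close> occur.\<close>
    have "card (S \<inter> B) \<le> card S" using fin by (intro card_mono) auto
    with 3 S(2) have "S \<inter> B = S" using fin by (intro card_subset_eq) auto
    then have "e - B \<subseteq> A" if "e \<in> X" for e using XE[OF that] by auto
    then have "dim (insert e0 (vecs X)) \<le> card A + 1"
      by (intro dim_coordinates_le) (auto simp: X_def)
    moreover have "dim (vecs X) \<le> dim (insert e0 (vecs X))" by (intro dim_subset) auto
    ultimately show ?thesis by simp
  qed
  then show ?thesis by (simp add: X_def)
qed

lemma three_connected_if_tutte: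
  assumes "tutte_connected 3 (dirichlet_ground E) (dirichlet_indep E B u)"
  shows "k_connected_graph 3 V (complete_boundary E B)"
proof (rule ccontr)
  assume "\<not> ?thesis"
  then obtain S where S: "S \<subseteq> V" "card S < 3"
      "\<not> connected_graph (V - S) (delete_vertices (complete_boundary E B) S)"
    by (rule not_k_connected_graphE)
  obtain i where i: "i \<in> V - B" using interior_nonempty by blast
  \<comment> \<open>There are at least three vertices, so deleting at most two leaves a nonempty
    graph.\<close>
  have "card (insert i B) \<le> card V"
    using i boundary_subset finite_V by (intro card_mono) auto
  moreover have "card (insert i B) = card B + 1" using i finite_B by simp
  ultimately have "card S < card V" using boundary_card S(2) by simp
  then have ne: "V - S \<noteq> {}" using S(1) by auto
  obtain U where U: "U \<subseteq> V - S" "U \<noteq> {}" "V - S - U \<noteq> {}" and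
      "\<And>a b. a \<in> U \<Longrightarrow> b \<in> V - S - U \<Longrightarrow> {a, b} \<notin> delete_vertices (complete_boundary E B) S"
    using not_connected_graphE[OF S(3) ne] by metis
  then have noU: "{a, b} \<notin> complete_boundary E B" if "a \<in> U" "b \<in> V - S - U" for a b
    using that by (auto simp: delete_vertices_def)
  \<comment> \<open>The boundary nodes outside \<open>S\<close> form a clique in the completed
    graph, so they all lie on one side of the cut. The other side is the required interior
    set.\<close>
  have "\<exists>A\<subseteq>V - S - B. A \<noteq> {} \<and> V - S - A \<noteq> {} \<and> (\<forall>a\<in>A. \<forall>b\<in>V - S - A. {a, b} \<notin> E)"
  proof (cases "U \<inter> B = {}")
    case True
    with U noU show ?thesis
      by (intro exI[of _ U]) (auto simp: complete_boundary_def)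
  next
    case False
    then obtain x where x: "x \<in> U" "x \<in> B" by blast
    have "y \<notin> B" if "y \<in> V - S - U" for y
      using noU[OF x(1) that] x that by (auto simp: complete_boundary_def)
    moreover have "{a, b} \<notin> E" if "a \<in> V - S - U" "b \<in> U" for a b
      using noU[OF that(2,1)] by (auto simp: complete_boundary_def insert_commute)
    moreover have "V - S - (V - S - U) = U" using U by blast
    ultimately show ?thesis
      using U by (intro exI[of _ "V - S - U"]) auto
  qed
  then obtain A where A: "A \<subseteq> V - S - B" "A \<noteq> {}" "V - S - A \<noteq> {}"
      and no: "\<And>a b. a \<in> A \<Longrightarrow> b \<in> V - S - A \<Longrightarrow> {a, b} \<notin> E"
    by blast
  have AB: "A \<subseteq> V - B" using A by blast
  obtain v where "v \<in> V - S - A" using A by blast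
  then obtain f where f: "f \<in> E" "f \<inter> A = {}"
    using edge_outside[of v A] AB no by blast
  have "dim (vecs {e \<in> E. e \<inter> A \<noteq> {}}) \<le> card A + 1"
  proof (rule dim_separated_set[OF AB A(2) S(1)])
    show "y \<in> A \<union> S" if "a \<in> A" "{a, y} \<in> E" for a y
      using that no[of a y] edge_subset[of "{a, y}"] by blast
  qed (use S in simp)
  then have "\<not> tutte_connected 3 (dirichlet_ground E) (dirichlet_indep E B u)"
    using AB A(2) f by (intro separation_of_vertex_set)
  with assms show False by simp
qed

section \<open>From graph connectivity to the matroid, and the equivalence\<close>

lemma tutte_if_graph_connected:
  assumes "connected_graph (V - B) (delete_vertices E B)"
    and "k_connected_graph 3 V (complete_boundary E B)"
  shows "tutte_connected 3 (dirichlet_ground E) (dirichlet_indep E B u)"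
proof -
  interpret threeconn_network V E B by unfold_locales fact+
  let ?sep = "\<lambda>k. tutte_separation k (dirichlet_ground E) (dirichlet_indep E B u)"
  \<comment> \<open>Separations are symmetric, so \<open>e0\<close>, encoded as \<open>None\<close>,
    may be assumed to lie in the second part. The first part then consists of edges only.\<close>
  have no: False if k: "k \<in> {1, 2}" and sep: "?sep k P Q" and N: "None \<in> Q" for k P Q
  proof -
    define X where "X = {e. Some e \<in> P}"
    from sep have PQ: "P \<union> Q = dirichlet_ground E" "P \<inter> Q = {}" "k \<le> card P" "k \<le> card Q"
      and r: "matroid_rank (dirichlet_indep E B u) P + matroid_rank (dirichlet_indep E B u) Q
        < matroid_rank (dirichlet_indep E B u) (dirichlet_ground E) + k"
      by (auto simp: tutte_separation_def)
    have X: "X \<subseteq> E" using PQ(1) by (auto simp: X_def dirichlet_ground_def)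
    have P: "P = Some ` X"
    proof (intro set_eqI)
      fix x show "x \<in> P \<longleftrightarrow> x \<in> Some ` X" using N PQ(2) by (cases x) (auto simp: X_def)
    qed
    have "Q = dirichlet_ground E - P" using PQ by blast
    then have Q: "Q = insert None (Some ` (E - X))"
      by (auto simp: P dirichlet_ground_def)
    have "card P = card X" "card Q = card (E - X) + 1"
      using finite_E by (simp_all add: P Q card_image)
    moreover have "matroid_rank (dirichlet_indep E B u) P = dim (vecs X)"
      "matroid_rank (dirichlet_indep E B u) Q = dim (insert e0 (vecs (E - X)))"
      "matroid_rank (dirichlet_indep E B u) (dirichlet_ground E) = card (V - B) + 1"
      using X rank_ground unfolding P Q
      by (subst rank_dirichlet; auto simp: dirichlet_ground_def dirichlet_vector_image)+
    ultimately show False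
      using no_small_separation[OF X k] separation_bound[OF X, of k] PQ r by simp
  qed
  have "False" if "1 \<le> k" "k < 3" "?sep k P Q" for k P Q
  proof -
    have k: "k \<in> {1, 2}" using that by auto
    have "None \<in> P \<union> Q" using that(3) by (auto simp: tutte_separation_def dirichlet_ground_def)
    moreover have "?sep k Q P" using that(3) by (auto simp: tutte_separation_def Un_commute Int_commute add.commute)
    ultimately show False using no[OF k] that(3) by blast
  qed
  then show ?thesis unfolding tutte_connected_def by blast
qed

end

theorem theorem1p3:
  fixes V :: "'v::finite set" and E :: "'v set set" and B :: "'v set" and u :: "'v \<Rightarrow> real"
  assumes "network V E B" and "inj_on u B"
  shows "tutte_connected 3 (dirichlet_ground E) (dirichlet_indep E B u) \<longleftrightarrow>
    connected_graph (V - B) (delete_vertices E B) \<and>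
    k_connected_graph 3 V (complete_boundary E B)"
proof -
  interpret network V E B by fact
  interpret dirichlet_network V E B u by unfold_locales fact
  show ?thesis
    using interior_connected_if_tutte three_connected_if_tutte tutte_if_graph_connected by blast
qed

end
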